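(* Let $m\geq 3$ and let $G=S(2^2,1^{m-2})$ be the starlike tree of order $m+3$, i.e. the tree on vertices $o,x_1,\dots,x_m,y,z$ with edges $ox_1,\dots,ox_m$, $x_1y$ and $x_2z$. Let $H$ be a distance-balanced graph which contains $G$ as a spanning subgraph. Then $\mathrm{diam}(H)\leq 2$, and hence $H$ is $r$-regular for some integer $r\geq m$.
   Context: All graphs are finite and simple. For vertices $u,v$ of a graph $H$, $d_H(u,v)$ is the length of a shortest $u$–$v$ path, and $\mathrm{diam}(H)=\max_{u,v} d_H(u,v)$. For an edge $xy$ of $H$, $W^H_{xy}=\{u\in V(H): d_H(u,x)<d_H(u,y)\}$. A graph $H$ is distance-balanced if $|W^H_{xy}|=|W^H_{yx}|$ for every edge $xy$ of $H$. A starlike tree is a tree with exactly one vertex of degree greater than two; $S(n_1^{\alpha_1},\dots,n_k^{\alpha_k})$ denotes the starlike tree in which deleting the central vertex leaves $\alpha_i$ paths with $n_i$ vertices for each $i$. *)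

theory Defs
  imports "Graph_Theory.Graph_Theory"
begin

text \<open>
  A finite simple graph is a symmetric digraph in the sense of the locale \<^locale>\<open>graph\<close>: an
  undirected edge is a pair of opposite arcs, so the degree of a vertex is its
  \<^const>\<open>out_degree\<close>.
\<close>

text \<open>
  With unit weights, the cost of a walk is its length. Distances are extended reals;
  vertices in different components are at distance \<open>\<infinity>\<close>.
\<close>
definition graph_dist :: "('a, 'b) pre_digraph \<Rightarrow> 'a \<Rightarrow> 'a \<Rightarrow> ereal" where
  "graph_dist H u v = wf_digraph.\<mu> H (\<lambda>_. 1) u v"

text \<open>The maximum is meaningful only when the vertex set is finite and nonempty.\<close>
definition diam :: "('a, 'b) pre_digraph \<Rightarrow> ereal" where
  "diam H = Max {graph_dist H u v | u v. u \<in> verts H \<and> v \<in> verts H}"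

definition closer_verts :: "('a, 'b) pre_digraph \<Rightarrow> 'a \<Rightarrow> 'a \<Rightarrow> 'a set" where
  "closer_verts H x y = {u \<in> verts H. graph_dist H u x < graph_dist H u y}"

definition distance_balanced :: "('a, 'b) pre_digraph \<Rightarrow> bool" where
  "distance_balanced H \<longleftrightarrow>
    (\<forall>x y. x \<rightarrow>\<^bsub>H\<^esub> y \<longrightarrow> card (closer_verts H x y) = card (closer_verts H y x))"

definition regular :: "nat \<Rightarrow> ('a, 'b) pre_digraph \<Rightarrow> bool" where
  "regular r H \<longleftrightarrow> (\<forall>v \<in> verts H. out_degree H v = r)"

datatype starlike_vertex = Centre | X nat | Y | Z

definition starlike_edges :: "nat \<Rightarrow> (starlike_vertex \<times> starlike_vertex) set" where
  "starlike_edges m = {(Centre, X i) | i. i \<in> {1..m}} \<union> {(X 1, Y), (X 2, Z)}"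

text \<open>
  The starlike tree $S(2^2,1^{m-2})$, for \<open>m \<ge> 3\<close>: deleting \<open>Centre\<close> leaves the two paths
  \<open>X 1, Y\<close> and \<open>X 2, Z\<close> and the \<open>m - 2\<close> single vertices \<open>X 3, \<dots>, X m\<close>.
\<close>
definition starlike_2_2_1s :: "nat \<Rightarrow> starlike_vertex pair_pre_digraph" where
  "starlike_2_2_1s m = \<lparr>
     pverts = {Centre, Y, Z} \<union> X ` {1..m},
     parcs = starlike_edges m \<union> (starlike_edges m)\<inverse> \<rparr>"

lemma pair_graph_starlike_2_2_1s:
  assumes "m \<ge> 2"
  shows "pair_graph (starlike_2_2_1s m)"
proof
  have "starlike_edges m = (\<lambda>i. (Centre, X i)) ` {1..m} \<union> {(X 1, Y), (X 2, Z)}"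
    by (auto simp: starlike_edges_def)
  then have "finite (starlike_edges m)"
    by simp
  then show "finite (parcs (starlike_2_2_1s m))"
    by (simp add: starlike_2_2_1s_def)
  show "symmetric (starlike_2_2_1s m)"
    by (auto simp: starlike_2_2_1s_def symmetric_def sym_def)
qed (use assms in \<open>auto simp: starlike_2_2_1s_def starlike_edges_def\<close>)

lemma card_starlike_2_2_1s: "card (pverts (starlike_2_2_1s m)) = m + 3"
proof -
  have "card (X ` {1..m}) = m"
    by (simp add: card_image inj_on_def)
  moreover have "{Centre, Y, Z} \<inter> X ` {1..m} = {}"
    by auto
  ultimately show ?thesis
    by (simp add: starlike_2_2_1s_def card_Un_disjoint del: Un_insert_left)
qed

end

theory Submission
  imports Defs
begin

text \<open>
  In a connected graph, distance-balancedness says that the transmission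
  $T(u) = \sum_w d(w,u)$ is the same for all vertices \<open>u\<close>, since
  $T(x) + |W_{xy}| = T(y) + |W_{yx}|$ for every edge $xy$. Let $n$ be the order. A vertex \<open>u\<close> of
  eccentricity at most 2 has $T(u) = 2(n-1) - \deg u$, which is at most $n + 1$ for the centre,
  whose degree is at least $n - 3$. A vertex with another one at distance at least 3 has
  transmission at least $(n - 1) + 2 + 1 = n + 2$, because some vertex then lies at distance 2 too.
  So the diameter is at most 2, and the formula for $T$ shows that all degrees agree.
\<close>

section \<open>Distances as natural numbers\<close>

context wf_digraph begin

text \<open>A natural-number distance, so that distances can be summed and compared by induction.
  When no walk from \<open>u\<close> to \<open>v\<close> exists the \<open>LEAST\<close> ranges over
  nothing and its value says nothing; reachability is therefore assumed wherever the value must come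
  from a walk.\<close>

definition hop_dist :: "'a \<Rightarrow> 'a \<Rightarrow> nat" where
  "hop_dist u v = (LEAST n. \<exists>p. awalk u p v \<and> length p = n)"

lemma awalk_cost_one: "awalk_cost (\<lambda>_. 1) p = real (length p)"
  by (induction p) auto

lemma hop_dist_le: "awalk u p v \<Longrightarrow> hop_dist u v \<le> length p"
  unfolding hop_dist_def by (rule Least_le) blast

lemma hop_dist_awalkE:
  assumes "u \<rightarrow>\<^sup>* v"
  obtains p where "awalk u p v" "length p = hop_dist u v"
proof -
  have "\<exists>n p. awalk u p v \<and> length p = n"
    using assms by (auto simp: reachable_awalk)
  then have "\<exists>p. awalk u p v \<and> length p = hop_dist u v"
    unfolding hop_dist_def by (rule LeastI_ex)
  then show thesis using that by blast
qed

text \<open>With unit weights the infimum over walks is attained, because lengths are natural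
  numbers. This is the bridge from the \<open>ereal\<close> distances to
  \<open>hop_dist\<close>.\<close>

lemma graph_dist_eq_hop_dist:
  assumes "u \<rightarrow>\<^sup>* v"
  shows "graph_dist G u v = ereal (real (hop_dist u v))"
proof -
  obtain p where p: "awalk u p v" "length p = hop_dist u v"
    using assms by (rule hop_dist_awalkE)
  show ?thesis
    unfolding graph_dist_def \<mu>_def awalk_cost_one
  proof (rule antisym)
    show "(INF p\<in>{p. awalk u p v}. ereal (real (length p))) \<le> ereal (real (hop_dist u v))"
      using p by (auto intro: INF_lower2)
    show "ereal (real (hop_dist u v)) \<le> (INF p\<in>{p. awalk u p v}. ereal (real (length p)))"
      by (auto intro!: INF_greatest hop_dist_le)
  qed
qed

lemma hop_dist_adj_le:
  assumes "u \<rightarrow>\<^sup>* v" "v \<rightarrow> w"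
  shows "hop_dist u w \<le> Suc (hop_dist u v)"
proof -
  obtain p where p: "awalk u p v" "length p = hop_dist u v"
    using assms(1) by (rule hop_dist_awalkE)
  obtain e where e: "e \<in> arcs G" "tail G e = v" "head G e = w"
    using assms(2) by (rule reachableE)
  have "awalk v [e] w"
    using e by (auto simp: awalk_Cons_iff awalk_Nil_iff)
  then have "awalk u (p @ [e]) w"
    using p(1) by (rule awalk_appendI[rotated])
  from hop_dist_le[OF this] p(2) show ?thesis by simp
qed

lemma hop_dist_self: "u \<in> verts G \<Longrightarrow> hop_dist u u = 0"
  using hop_dist_le[of u "[]" u] by (simp add: awalk_Nil_iff)

lemma hop_dist_0_imp_eq:
  assumes "u \<rightarrow>\<^sup>* v" "hop_dist u v = 0"
  shows "u = v"
  using hop_dist_awalkE[OF assms(1)] assms(2) by (metis awalk_Nil_iff length_0_conv)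

text \<open>Remove the first arc of a shortest walk: if the remainder were not shortest, prepending
  that arc to a shorter one would beat the original walk.\<close>

lemma hop_dist_SucE:
  assumes "u \<rightarrow>\<^sup>* v" "hop_dist u v = Suc k"
  obtains w where "u \<rightarrow> w" "w \<rightarrow>\<^sup>* v" "hop_dist w v = k"
proof -
  obtain p where p: "awalk u p v" "length p = Suc k"
    using hop_dist_awalkE[OF assms(1)] assms(2) by metis
  then obtain e q where q: "p = e # q" "length q = k"
    by (auto simp: length_Suc_conv)
  define w where "w = head G e"
  have e: "e \<in> arcs G" "tail G e = u" and wq: "awalk w q v"
    using p(1) by (auto simp: q(1) w_def awalk_Cons_iff)
  have adj: "u \<rightarrow> w"
    using e by (auto simp: w_def arcs_ends_conv)
  obtain r where r: "awalk w r v" "length r = hop_dist w v"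
    using hop_dist_awalkE reachable_awalkI[OF wq] by blast
  have "awalk u (e # r) v"
    using r(1) e by (auto simp: awalk_Cons_iff w_def)
  then have "Suc k \<le> Suc (hop_dist w v)"
    using hop_dist_le[of u "e # r" v] r(2) assms(2) by simp
  moreover have "hop_dist w v \<le> k"
    using hop_dist_le[OF wq] q(2) by simp
  ultimately show thesis
    using that adj reachable_awalkI[OF wq] by simp
qed

lemma hop_dist_eq_1_iff:
  assumes "u \<rightarrow>\<^sup>* v" "u \<noteq> v"
  shows "hop_dist u v = 1 \<longleftrightarrow> u \<rightarrow> v"
proof
  assume "hop_dist u v = 1"
  then obtain w where "u \<rightarrow> w" "w \<rightarrow>\<^sup>* v" "hop_dist w v = 0"
    using hop_dist_SucE[OF assms(1)] by (metis One_nat_def)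
  then show "u \<rightarrow> v" using hop_dist_0_imp_eq by blast
next
  assume "u \<rightarrow> v"
  then have "hop_dist u v \<le> 1"
    using hop_dist_adj_le[of u u v] hop_dist_self adj_in_verts by fastforce
  moreover have "hop_dist u v \<noteq> 0"
    using hop_dist_0_imp_eq assms by blast
  ultimately show "hop_dist u v = 1" by simp
qed

text \<open>Along a shortest walk to \<open>v\<close> the distance to \<open>v\<close> drops by
  exactly one at each arc, so every value below the initial one occurs. The induction descends from
  \<open>hop_dist u v\<close> to \<open>k\<close>.\<close>

lemma ex_hop_dist_eq:
  assumes "u \<rightarrow>\<^sup>* v" "k \<le> hop_dist u v"
  obtains w where "w \<rightarrow>\<^sup>* v" "hop_dist w v = k"
proof -
  have "\<exists>w. w \<rightarrow>\<^sup>* v \<and> hop_dist w v = k"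
    using assms(2) by (induction rule: inc_induct) (use assms(1) hop_dist_SucE in \<open>blast+\<close>)
  then show thesis using that by blast
qed

end

text \<open>Without parallel arcs an arc leaving \<open>u\<close> is determined by its head, so
  counting arcs is counting neighbours.\<close>

lemma (in nomulti_digraph) out_degree_eq_card_adj:
  "out_degree G u = card (arcs_ends G `` {u})"
proof -
  have "inj_on (head G) (out_arcs G u)"
    by (rule inj_onI) (auto intro!: no_multi_arcs simp: arc_to_ends_def)
  moreover have "head G ` out_arcs G u = arcs_ends G `` {u}"
    by (auto simp: arcs_ends_conv)
  ultimately show ?thesis
    unfolding out_degree_def using card_image by fastforce
qed

section \<open>Transmissions\<close>

context graph begin

text \<open>Distances are taken towards \<open>u\<close>, the same orientation as in
  \<open>closer_verts\<close>.\<close>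

definition transmission :: "'a \<Rightarrow> nat" where
  "transmission u = (\<Sum>w\<in>verts G. hop_dist w u)"

text \<open>Both sides count vertex by vertex: as \<open>x\<close> and \<open>y\<close> are
  adjacent, the distances from \<open>w\<close> to them differ by at most one, so adding one to the
  strictly smaller turns either into the maximum of the two.\<close>

lemma transmission_diff:
  assumes sc: "strongly_connected G" and adj: "x \<rightarrow> y"
  shows "transmission x + card (closer_verts G x y) = transmission y + card (closer_verts G y x)"
proof -
  have adj': "y \<rightarrow> x"
    using arcs_ends_symmetric[OF sym_arcs adj] .
  have xy: "x \<in> verts G" "y \<in> verts G"
    using adj_in_verts[OF adj] .
  have reach: "u \<rightarrow>\<^sup>* v" if "u \<in> verts G" "v \<in> verts G" for u v
    using sc that by auto
  have card_eq: "card (closer_verts G u v) = (\<Sum>w\<in>verts G. of_bool (hop_dist w u < hop_dist w v))"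
    if "u \<in> verts G" "v \<in> verts G" for u v
  proof -
    have "closer_verts G u v = {w \<in> verts G. hop_dist w u < hop_dist w v}"
      unfolding closer_verts_def using that reach by (auto simp: graph_dist_eq_hop_dist)
    then show ?thesis by (simp add: sum.If_cases of_bool_def Int_def)
  qed
  have "hop_dist w x + of_bool (hop_dist w x < hop_dist w y)
      = hop_dist w y + of_bool (hop_dist w y < hop_dist w x)" if "w \<in> verts G" for w
    using hop_dist_adj_le[OF reach[OF that xy(1)] adj]
      hop_dist_adj_le[OF reach[OF that xy(2)] adj'] by (auto simp: of_bool_def)
  then show ?thesis
    unfolding transmission_def card_eq[OF xy] card_eq[OF xy(2,1)] sum.distrib[symmetric]
    by (intro sum.cong) auto
qed

text \<open>On each edge the two cardinalities in \<open>transmission_diff\<close> are equal and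
  cancel; connectivity carries the equality along a walk from \<open>u\<close> to
  \<open>v\<close>.\<close>

lemma distance_balanced_imp_transmission_eq:
  assumes sc: "strongly_connected G" and "distance_balanced G"
    and "u \<in> verts G" "v \<in> verts G"
  shows "transmission u = transmission v"
proof -
  have "u \<rightarrow>\<^sup>* v" using assms by auto
  then show ?thesis
  proof (induction rule: converse_reachable_induct)
    case (step x y)
    then show ?case
      using transmission_diff[OF sc step(1)] assms(2)
      unfolding distance_balanced_def by (metis add_right_cancel)
  qed simp
qed

lemma transmission_eq:
  assumes "u \<in> verts G"
  shows "transmission u = (\<Sum>w\<in>verts G - {u}. hop_dist w u)"
  unfolding transmission_def using assms by (simp add: sum.remove hop_dist_self)

text \<open>Every vertex other than \<open>u\<close> is at distance 1 or 2. Counting the neighbours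
  once more raises each contribution to exactly 2.\<close>

lemma transmission_plus_degree:
  assumes sc: "strongly_connected G" and u: "u \<in> verts G"
    and ecc: "\<And>w. w \<in> verts G \<Longrightarrow> hop_dist w u \<le> 2"
  shows "transmission u + out_degree G u = 2 * (card (verts G) - 1)"
proof -
  have reach: "w \<rightarrow>\<^sup>* u" if "w \<in> verts G" for w
    using sc u that by auto
  have sym: "u \<rightarrow> w \<longleftrightarrow> w \<rightarrow> u" for w
    using arcs_ends_symmetric[OF sym_arcs] by blast
  \<comment> \<open>The degree counts arcs leaving \<open>u\<close>, the transmission measures walks
    into \<open>u\<close>; symmetry of the arcs reconciles the two.\<close>
  have "arcs_ends G `` {u} = {w \<in> verts G - {u}. hop_dist w u = 1}"
    (is "?L = ?R")
  proof (rule set_eqI)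
    fix w
    show "w \<in> ?L \<longleftrightarrow> w \<in> ?R"
      using hop_dist_eq_1_iff[OF reach] adj_in_verts(2)[of u w] adj_not_same[of u] sym[of w]
      by blast
  qed
  then have "out_degree G u = (\<Sum>w\<in>verts G - {u}. of_bool (hop_dist w u = 1))"
    unfolding out_degree_eq_card_adj by (simp add: sum.If_cases of_bool_def Int_def)
  then have "transmission u + out_degree G u
      = (\<Sum>w\<in>verts G - {u}. hop_dist w u + of_bool (hop_dist w u = 1))"
    by (simp add: transmission_eq[OF u] sum.distrib)
  also have "\<dots> = (\<Sum>w\<in>verts G - {u}. 2)"
  proof (rule sum.cong)
    fix w assume w: "w \<in> verts G - {u}"
    then have "hop_dist w u \<noteq> 0" "hop_dist w u \<le> 2"
      using hop_dist_0_imp_eq reach ecc by auto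
    then show "hop_dist w u + of_bool (hop_dist w u = 1) = 2" by (auto simp: of_bool_def)
  qed simp
  also have "\<dots> = 2 * (card (verts G) - 1)"
    using u by simp
  finally show ?thesis .
qed

lemma transmission_ge:
  assumes sc: "strongly_connected G" and "x \<in> verts G" "u \<in> verts G" "hop_dist x u \<ge> 3"
  shows "transmission u \<ge> card (verts G) + 2"
proof -
  have reach: "w \<rightarrow>\<^sup>* u" if "w \<in> verts G" for w
    using sc assms(3) that by auto
  \<comment> \<open>A vertex on a shortest walk from \<open>x\<close> to \<open>u\<close>.\<close>
  obtain y where y: "y \<rightarrow>\<^sup>* u" "hop_dist y u = 2"
    using ex_hop_dist_eq[OF reach[OF assms(2)], of 2] assms(4) by auto
  have "y \<in> verts G" using reachable_in_verts(1)[OF y(1)] .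
  have neq: "x \<noteq> y" "x \<noteq> u" "y \<noteq> u"
    using y(2) assms(4) hop_dist_self[OF assms(3)] by auto
  have "card (verts G) + 2 = (\<Sum>w\<in>verts G - {u}. 1) + 3"
    using card.remove[OF finite_verts assms(3)] by simp
  \<comment> \<open>The surplus 3 is split as 2 at \<open>x\<close> (distance at least 3) and 1 at
    \<open>y\<close> (distance 2), over a base of 1 for each vertex.\<close>
  also have "\<dots> = (\<Sum>w\<in>verts G - {u}. 1 + (if w = x then 2 else 0) + (if w = y then 1 else 0))"
    using neq assms(2) \<open>y \<in> verts G\<close> by (simp only: sum.distrib) simp
  also have "\<dots> \<le> (\<Sum>w\<in>verts G - {u}. hop_dist w u)"
  proof (rule sum_mono)
    fix w assume w: "w \<in> verts G - {u}"
    then have "hop_dist w u \<noteq> 0"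
      using hop_dist_0_imp_eq reach by auto
    then show "1 + (if w = x then 2 else 0) + (if w = y then 1 else 0) \<le> hop_dist w u"
      using y(2) assms(4) neq by auto
  qed
  finally show ?thesis using transmission_eq assms(3) by simp
qed

text \<open>The starlike tree enters only through its centre \<open>c\<close>: within distance 2 of
  every vertex, and adjacent to all but at most two of the others.\<close>

theorem distance_balanced_diam_le_2_regular:
  assumes db: "distance_balanced G"
    and c: "c \<in> verts G" and deg: "card (verts G) \<le> out_degree G c + 3"
    and ecc: "\<And>v. v \<in> verts G \<Longrightarrow> graph_dist G v c \<le> 2"
  shows "diam G \<le> 2 \<and> regular (out_degree G c) G"
proof -
  have to_c: "v \<rightarrow>\<^sup>* c" if "v \<in> verts G" for v
  proof -
    \<comment> \<open>Unreachable vertices are at distance \<infinity>, so the bound 2 already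
      forces reachability; with symmetric arcs, connectivity follows.\<close>
    have "\<mu> (\<lambda>_. 1) v c \<le> 2"
      using ecc[OF that] by (simp add: graph_dist_def)
    also have "(2 :: ereal) < \<infinity>" by simp
    finally show ?thesis by (simp only: \<mu>_reach_conv)
  qed
  have sc: "strongly_connected G"
    using c to_c by (auto intro: reachable_trans symmetric_reachable')
  then have reach: "u \<rightarrow>\<^sup>* v" if "u \<in> verts G" "v \<in> verts G" for u v
    using that by auto
  have "hop_dist v c \<le> 2" if "v \<in> verts G" for v
    using ecc[OF that] by (simp add: graph_dist_eq_hop_dist[OF to_c[OF that]])
  then have Tc: "transmission c + out_degree G c = 2 * (card (verts G) - 1)"
    using transmission_plus_degree sc c by blast
  have le2: "hop_dist v u \<le> 2" if "v \<in> verts G" "u \<in> verts G" for u v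
  proof (rule ccontr)
    assume "\<not> hop_dist v u \<le> 2"
    then have "transmission u \<ge> card (verts G) + 2"
      using transmission_ge[OF sc that] by simp
    moreover have "transmission u = transmission c"
      using distance_balanced_imp_transmission_eq[OF sc db that(2) c] .
    moreover have "card (verts G) > 0"
      using c by (auto simp: card_gt_0_iff)
    \<comment> \<open>With $n$ the order, the degree of \<open>c\<close> is at least $n - 3$, so its
      transmission is at most $2(n-1) - (n-3) = n + 1$, below the $n + 2$ forced at
      \<open>u\<close>.\<close>
    ultimately show False using Tc deg by linarith
  qed
  \<comment> \<open>Written as an image of a finite set, nonempty because of \<open>c\<close>, so
    that the \<open>Max\<close> in \<open>diam_def\<close> is a genuine maximum.\<close>
  have "{graph_dist G u v |u v. u \<in> verts G \<and> v \<in> verts G}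
      = (\<lambda>(u, v). graph_dist G u v) ` (verts G \<times> verts G)"
    by auto
  moreover have "graph_dist G u v \<le> 2" if "u \<in> verts G" "v \<in> verts G" for u v
    using le2[OF that] by (simp add: graph_dist_eq_hop_dist[OF reach[OF that]])
  ultimately have "diam G \<le> 2"
    unfolding diam_def using c by (subst Max_le_iff) (auto simp del: ereal_less_eq)
  \<comment> \<open>Transmission plus degree is now the same constant at every vertex, and so is the
    transmission.\<close>
  moreover have "out_degree G u = out_degree G c" if "u \<in> verts G" for u
    using transmission_plus_degree[OF sc that] le2 that Tc
      distance_balanced_imp_transmission_eq[OF sc db that c] by fastforce
  ultimately show ?thesis by (simp add: regular_def)
qed

end

section \<open>Graphs spanned by the starlike tree\<close>

lemma (in wf_digraph) graph_dist_le_length: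
  "awalk u p v \<Longrightarrow> graph_dist G u v \<le> ereal (real (length p))"
  using graph_dist_eq_hop_dist[OF reachable_awalkI] hop_dist_le by simp

text \<open>The three alternatives are walks of 0, 1 and 2 arcs; in the tree they serve the centre,
  the vertices \<open>X i\<close>, and \<open>Y\<close> and \<open>Z\<close>.\<close>

lemma (in wf_digraph) graph_dist_le_2:
  assumes "v \<in> verts G" "v = c \<or> v \<rightarrow> c \<or> (\<exists>w. v \<rightarrow> w \<and> w \<rightarrow> c)"
  shows "graph_dist G v c \<le> 2"
proof -
  have "\<exists>p. awalk v p c \<and> length p \<le> 2"
    using assms(2)
  proof (elim disjE exE conjE)
    assume "v = c"
    then show ?thesis using assms(1) by (intro exI[of _ "[]"]) (simp add: awalk_Nil_iff)
  next
    assume "v \<rightarrow> c"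
    then obtain e where "e \<in> arcs G" "tail G e = v" "head G e = c" by (rule reachableE)
    then show ?thesis
      by (intro exI[of _ "[e]"]) (auto simp: awalk_Cons_iff awalk_Nil_iff)
  next
    fix w assume "v \<rightarrow> w" "w \<rightarrow> c"
    then obtain e e' where "e \<in> arcs G" "tail G e = v" "head G e = w"
      "e' \<in> arcs G" "tail G e' = w" "head G e' = c" by (metis reachableE)
    then show ?thesis
      by (intro exI[of _ "[e, e']"]) (auto simp: awalk_Cons_iff awalk_Nil_iff)
  qed
  then obtain p where p: "awalk v p c" "length p \<le> 2" by blast
  then have "ereal (real (length p)) \<le> 2" by simp
  then show ?thesis using graph_dist_le_length[OF p(1)] by (rule order_trans[rotated])
qed

theorem theorem4p1:
  fixes m :: nat and G H :: "('a, 'b) pre_digraph"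
  assumes "m \<ge> 3"
    and "digraph_iso (starlike_2_2_1s m) G"
    and "graph H"
    and "distance_balanced H"
    and "spanning G H"
  shows "diam H \<le> 2 \<and> (\<exists>r\<ge>m. regular r H)"
proof -
  interpret graph H by fact
  let ?S = "with_proj (starlike_2_2_1s m)"
  obtain h where iso: "pre_digraph.digraph_isomorphism ?S h" and G: "G = app_iso h ?S"
    using assms(2) by (auto simp: digraph_iso_def)
  have wf: "wf_digraph ?S"
    using iso by (simp add: pre_digraph.digraph_isomorphism_def)
  \<comment> \<open>\<open>G\<close> is only an isomorphic copy of the tree, so all facts about the
    tree are transported along this vertex map.\<close>
  define f where "f = iso_verts h"
  have inj: "inj_on f (pverts (starlike_2_2_1s m))"
    using pre_digraph.digraph_isomorphism_inj_on_verts[OF iso] by (simp add: f_def)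
  have verts: "verts H = f ` pverts (starlike_2_2_1s m)"
    using assms(5) by (auto simp: spanning_def G f_def)
  have n: "card (verts H) = m + 3"
    unfolding verts by (simp add: card_image[OF inj] card_starlike_2_2_1s)
  have "arcs_ends G \<subseteq> arcs_ends H"
    using assms(5) by (auto simp: spanning_def subgraph_def compatible_def arcs_ends_conv)
  then have adj: "f u \<rightarrow>\<^bsub>H\<^esub> f v" if "(u, v) \<in> parcs (starlike_2_2_1s m)" for u v
    using that wf_digraph.arcs_ends_app_iso_eq[OF wf iso] by (force simp: G f_def)
  have adj_CX: "f Centre \<rightarrow>\<^bsub>H\<^esub> f (X i)" "f (X i) \<rightarrow>\<^bsub>H\<^esub> f Centre" if "i \<in> {1..m}" for i
    using that by (auto intro!: adj simp: starlike_2_2_1s_def starlike_edges_def)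
  have adj_YX: "f Y \<rightarrow>\<^bsub>H\<^esub> f (X 1)" and adj_ZX: "f Z \<rightarrow>\<^bsub>H\<^esub> f (X 2)"
    by (auto intro!: adj simp: starlike_2_2_1s_def starlike_edges_def)
  \<comment> \<open>The images of the \<open>X i\<close> are $m$ distinct neighbours of the centre
    in \<open>H\<close>. As the order is $m + 3$, this is the required degree bound.\<close>
  have "X ` {1..m} \<subseteq> pverts (starlike_2_2_1s m)"
    by (auto simp: starlike_2_2_1s_def)
  then have "inj_on f (X ` {1..m})"
    using inj inj_on_subset by blast
  moreover have "inj_on X {1..m}"
    by (simp add: inj_on_def)
  ultimately have "card (f ` X ` {1..m}) = m"
    by (simp add: card_image)
  moreover have "card (f ` X ` {1..m}) \<le> card (arcs_ends H `` {f Centre})"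
    using adj_CX adj_in_verts by (intro card_mono finite_subset[OF _ finite_verts]) auto
  ultimately have deg: "m \<le> out_degree H (f Centre)"
    by (simp add: out_degree_eq_card_adj)
  have centre: "f Centre \<in> verts H"
    by (auto simp: verts starlike_2_2_1s_def)
  have "graph_dist H v (f Centre) \<le> 2" if "v \<in> verts H" for v
  proof (rule graph_dist_le_2[OF that])
    obtain u where u: "v = f u" "u \<in> {Centre, Y, Z} \<union> X ` {1..m}"
      using \<open>v \<in> verts H\<close> by (auto simp: verts starlike_2_2_1s_def)
    show "v = f Centre \<or> v \<rightarrow>\<^bsub>H\<^esub> f Centre \<or> (\<exists>w. v \<rightarrow>\<^bsub>H\<^esub> w \<and> w \<rightarrow>\<^bsub>H\<^esub> f Centre)"
      using u adj_CX(2) adj_YX adj_ZX assms(1)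
      by (auto intro: exI[of _ "f (X 1)"] exI[of _ "f (X 2)"])
  qed
  \<comment> \<open>The witness $r$ is the degree of the centre in \<open>H\<close>.\<close>
  then show ?thesis
    using distance_balanced_diam_le_2_regular[OF assms(4) centre] n deg by auto
qed

end
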